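(* Let $Q=\mathrm{Diag}(\{q_1,\dots,q_n\})\in\mathbb{R}^{n\times n}$ be a diagonal matrix with $\lambda_Q=\min_i q_i<0$, let $g\in\mathbb{R}^n$, $A\in\mathbb{R}^{m\times n}$, and let $\mathcal{K}=\mathbb{R}^m_+$. Let $J=\{j: q_j=\lambda_Q\}$, let $A_J$ be the matrix composed of the columns of $A$ corresponding to the indices in $J$, and let $g_J$ be the subvector of $g$ with indices in $J$. Then the following two conditions are equivalent: (1) There exists a vector $d\in\mathbb{R}^n$, $d\ne 0$, such that $Qd=\lambda_Q d$, $Ad\in\mathcal{K}$ and $g^\top d\le 0$. (2) For all $\epsilon>0$ there exists $h_\epsilon\in\mathbb{R}^{|J|}$ with $\|h_\epsilon\|\le\epsilon$ such that $\{\mu\in\mathbb{R}^m:\ \mu\ge 0,\ -A_J^\top\mu+g_J+h_\epsilon=0\}=\emptyset$.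
   Context: $\|\cdot\|$ is the Euclidean norm. $\mathbb{R}^m_+$ is the nonnegative orthant and $\mu\ge0$ is meant entrywise. $\mathrm{Diag}(\{q_1,\dots,q_n\})$ is the diagonal matrix with diagonal entries $q_1,\dots,q_n$. In the underlying optimization problem the linear constraints are $Ay-b\in\mathcal{K}$, i.e. $Ay\ge b$. *)

theory Defs
  imports "HOL-Analysis.L2_Norm" "Jordan_Normal_Form.DL_Submatrix"
begin

definition nonneg_orthant :: "nat \<Rightarrow> real vec set" where
  "nonneg_orthant m = {v \<in> carrier_vec m. 0\<^sub>v m \<le> v}"

definition vec_norm :: "real vec \<Rightarrow> real" where
  "vec_norm v = L2_set (\<lambda>i. vec_index v i) {..<dim_vec v}"

(* The indices in J are enumerated in increasing order by pick, as in submatrix,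
   so the entries of subvec v J match the columns of submatrix A UNIV J. *)
definition subvec :: "'a vec \<Rightarrow> nat set \<Rightarrow> 'a vec" where
  "subvec v J = vec (card {j. j < dim_vec v \<and> j \<in> J}) (\<lambda>k. vec_index v (pick J k))"

end

theory Submission
  imports "HOL-Analysis.Function_Topology" Defs
begin

text \<open>
  The eigenvectors of \<open>Q\<close> for \<open>\<lambda>\<^sub>Q\<close> are the vectors supported on \<open>J\<close>, so with \<open>B = A\<^sub>J\<close> and
  \<open>c = g\<^sub>J\<close> the first condition asks for some \<open>z \<noteq> 0\<close> with \<open>B z \<ge> 0\<close> and \<open>c \<bullet> z \<le> 0\<close>, while the
  second says that \<open>c\<close> is not an interior point of the cone \<open>{B\<^sup>T \<mu> | \<mu> \<ge> 0}\<close>.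
  A direction \<open>z\<close> as above excludes \<open>c - t z\<close> from the cone for all \<open>t > 0\<close>.
  If there is no such \<open>z\<close>, compactness of the unit sphere makes
  \<open>f z = p \<bullet> z + \<parallel>(B z)\<^sup>-\<parallel>\<^sup>2\<close> nonnegative far from the origin, uniformly for \<open>p\<close> near \<open>c\<close>.
  Hence \<open>f\<close> has a minimizer, and the vanishing of its gradient there exhibits \<open>p = B\<^sup>T \<mu>\<close> with
  \<open>\<mu> = 2 (B z)\<^sup>- \<ge> 0\<close>. This avoids Farkas' lemma and the closedness of finitely generated cones.
\<close>

text \<open>
  The dimension \<open>card J\<close> is a term, not a type, so vectors are modelled as functions that vanish
  outside \<open>J\<close>, with the product topology.
\<close>
lemma compact_l1_ball:
  fixes J :: "'j set" and r :: real
  assumes "finite J"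
  shows "compact {z :: 'j \<Rightarrow> real. (\<forall>j. j \<notin> J \<longrightarrow> z j = 0) \<and> (\<Sum>j\<in>J. \<bar>z j\<bar>) \<le> r}"
proof -
  \<comment> \<open>Pinning the coordinates outside \<open>J\<close> to \<open>{0}\<close> keeps
    every factor compact, so Tychonoff applies even if the type \<open>'j\<close> is infinite. The
    l1 ball is then a closed subset of this box.\<close>
  let ?S = "\<lambda>j. if j \<in> J then {- r..r} else {0 :: real}"
  have "compactin (product_topology (\<lambda>j. euclidean) UNIV) (PiE UNIV ?S)"
    by (auto simp: compactin_PiE)
  then have box: "compact (PiE UNIV ?S)"
    by (simp add: euclidean_product_topology)
  have "closed {z :: 'j \<Rightarrow> real. (\<Sum>j\<in>J. \<bar>z j\<bar>) \<le> r}"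
    by (intro closed_Collect_le continuous_intros continuous_on_product_coordinates)
  then have "compact (PiE UNIV ?S \<inter> {z. (\<Sum>j\<in>J. \<bar>z j\<bar>) \<le> r})"
    using box by blast
  moreover have "\<bar>z j\<bar> \<le> r" if "(\<Sum>j\<in>J. \<bar>z j\<bar>) \<le> r" "j \<in> J" for z :: "'j \<Rightarrow> real" and j
    using member_le_sum[of j J "\<lambda>j. \<bar>z j\<bar>"] that assms by force
  then have "PiE UNIV ?S \<inter> {z. (\<Sum>j\<in>J. \<bar>z j\<bar>) \<le> r} =
      {z. (\<forall>j. j \<notin> J \<longrightarrow> z j = 0) \<and> (\<Sum>j\<in>J. \<bar>z j\<bar>) \<le> r}"
    by (fastforce simp: PiE_iff abs_le_iff split: if_splits)
  ultimately show ?thesis by simp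
qed

section \<open>First-order conditions at a minimizer of the penalized functional\<close>

text \<open>Near the origin the linear term dominates, so a nonzero \<open>\<alpha>\<close> would
  force a negative value at a small \<open>t\<close> of the opposite sign. This replaces
  differentiation in \<open>minimizer_imp_in_cone\<close>.\<close>

lemma linear_coeff_eq_0_if_quadratic_nonneg:
  fixes \<alpha> \<beta> :: real
  assumes "\<And>t. 0 \<le> t * \<alpha> + t\<^sup>2 * \<beta>"
  shows "\<alpha> = 0"
proof (rule ccontr)
  assume "\<alpha> \<noteq> 0"
  \<comment> \<open>This choice turns the expression into \<open>t\<^sup>2\<close> times
    \<open>\<beta> - \<bar>\<beta>\<bar> - 1\<close>, and the second factor is at most -1.\<close>
  define t where "t = - \<alpha> / (\<bar>\<beta>\<bar> + 1)"
  have t: "t * (\<bar>\<beta>\<bar> + 1) = - \<alpha>" by (simp add: t_def)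
  have "t \<noteq> 0" using \<open>\<alpha> \<noteq> 0\<close> t by auto
  have "t * \<alpha> + t\<^sup>2 * \<beta> = t\<^sup>2 * (\<beta> - (\<bar>\<beta>\<bar> + 1))"
  proof -
    have "t * \<alpha> = - (t * (t * (\<bar>\<beta>\<bar> + 1)))" unfolding t by simp
    then show ?thesis by (simp add: algebra_simps power2_eq_square)
  qed
  also have "\<dots> < 0"
    using \<open>t \<noteq> 0\<close> by (intro mult_pos_neg) auto
  finally show False using assms[of t] by simp
qed

text \<open>The negative part of \<open>x + y\<close> is its distance to the nonnegative half-line,
  hence at most its distance \<open>\<bar>max 0 (- x) - y\<bar>\<close> to the point
  \<open>max 0 x\<close>. For fixed \<open>x\<close> this gives a quadratic majorant in
  \<open>y\<close> that is exact at \<open>y = 0\<close>.\<close>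

lemma max_0_square_le: "(max 0 (- (x + y)))\<^sup>2 \<le> (max 0 (- x) - y)\<^sup>2" for x y :: real
proof -
  have "\<bar>max 0 (- (x + y))\<bar> \<le> \<bar>max 0 (- x) - y\<bar>" by linarith
  then show ?thesis by (rule abs_le_square_iff[THEN iffD1])
qed

lemma sum_upd_coordinate:
  fixes z b :: "'j \<Rightarrow> real"
  assumes "finite J" "k \<in> J"
  shows "(\<Sum>j\<in>J. b j * (z(k := z k + t)) j) = (\<Sum>j\<in>J. b j * z j) + t * b k"
proof -
  have "(\<Sum>j\<in>J. b j * (z(k := z k + t)) j) = (\<Sum>j\<in>J. b j * z j + (if j = k then t * b k else 0))"
    by (intro sum.cong) (auto simp: algebra_simps)
  then show ?thesis using assms by (simp add: sum.distrib)
qed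

text \<open>The partial derivative in coordinate \<open>k\<close> vanishes at the minimizer, where
  \<open>(max 0 (- x))\<^sup>2\<close> contributes the derivative \<open>- 2 * max 0 (- x)\<close>.
  Instead of differentiating, the proof moves \<open>z\<close> by \<open>t\<close> along
  \<open>k\<close>: the change is at most a quadratic in \<open>t\<close> by
  \<open>max_0_square_le\<close>, and minimality keeps that quadratic nonnegative.\<close>

lemma minimizer_imp_in_cone:
  fixes B :: "'i \<Rightarrow> 'j \<Rightarrow> real"
  assumes "finite I" "finite J" "k \<in> J"
    and min: "\<And>w. (\<And>j. j \<notin> J \<Longrightarrow> w j = 0) \<Longrightarrow>
      (\<Sum>j\<in>J. p j * z j) + (\<Sum>i\<in>I. (max 0 (- (\<Sum>j\<in>J. B i j * z j)))\<^sup>2)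
      \<le> (\<Sum>j\<in>J. p j * w j) + (\<Sum>i\<in>I. (max 0 (- (\<Sum>j\<in>J. B i j * w j)))\<^sup>2)"
    and supp: "\<And>j. j \<notin> J \<Longrightarrow> z j = 0"
  shows "(\<Sum>i\<in>I. 2 * max 0 (- (\<Sum>j\<in>J. B i j * z j)) * B i k) = p k"
proof -
  let ?u = "\<lambda>i. max 0 (- (\<Sum>j\<in>J. B i j * z j))"
  have "0 \<le> t * (p k - (\<Sum>i\<in>I. 2 * ?u i * B i k)) + t\<^sup>2 * (\<Sum>i\<in>I. (B i k)\<^sup>2)" for t
  proof -
    let ?w = "z(k := z k + t)"
    have "(\<Sum>i\<in>I. (max 0 (- (\<Sum>j\<in>J. B i j * ?w j)))\<^sup>2) \<le> (\<Sum>i\<in>I. (?u i - t * B i k)\<^sup>2)"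
      unfolding sum_upd_coordinate[OF assms(2,3)] by (intro sum_mono max_0_square_le)
    also have "\<dots> = (\<Sum>i\<in>I. (?u i)\<^sup>2 - t * (2 * ?u i * B i k) + t\<^sup>2 * (B i k)\<^sup>2)"
      by (intro sum.cong) (simp_all add: power2_eq_square algebra_simps)
    also have "\<dots> = (\<Sum>i\<in>I. (?u i)\<^sup>2) - t * (\<Sum>i\<in>I. 2 * ?u i * B i k) + t\<^sup>2 * (\<Sum>i\<in>I. (B i k)\<^sup>2)"
      by (simp add: sum.distrib sum_subtractf sum_distrib_left)
    finally have 1: "(\<Sum>i\<in>I. (max 0 (- (\<Sum>j\<in>J. B i j * ?w j)))\<^sup>2) \<le> \<dots>" .
    have 2: "(\<Sum>j\<in>J. p j * z j) + (\<Sum>i\<in>I. (?u i)\<^sup>2)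
        \<le> (\<Sum>j\<in>J. p j * ?w j) + (\<Sum>i\<in>I. (max 0 (- (\<Sum>j\<in>J. B i j * ?w j)))\<^sup>2)"
      using supp assms(3) by (intro min) auto
    have 3: "(\<Sum>j\<in>J. p j * ?w j) = (\<Sum>j\<in>J. p j * z j) + t * p k"
      by (rule sum_upd_coordinate[OF assms(2,3)])
    show ?thesis using 1 2 unfolding 3 by (simp add: right_diff_distrib)
  qed
  from linear_coeff_eq_0_if_quadratic_nonneg[OF this] show ?thesis by simp
qed

text \<open>The objective is 0 at the origin and nonnegative outside the l1 ball of radius
  \<open>M\<close>, so a minimizer over the compact ball is a global one. Its first-order conditions
  in all coordinates of \<open>J\<close> share one multiplier, twice the negative part of
  \<open>B z\<close>.\<close>

lemma coercive_imp_in_cone: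
  fixes B :: "'i \<Rightarrow> 'j \<Rightarrow> real"
  assumes "finite I" "finite J" "0 \<le> M"
    and coercive: "\<And>z. (\<And>j. j \<notin> J \<Longrightarrow> z j = 0) \<Longrightarrow> (\<Sum>j\<in>J. \<bar>z j\<bar>) > M \<Longrightarrow>
      0 \<le> (\<Sum>j\<in>J. p j * z j) + (\<Sum>i\<in>I. (max 0 (- (\<Sum>j\<in>J. B i j * z j)))\<^sup>2)"
  shows "\<exists>u. (\<forall>i\<in>I. 0 \<le> u i) \<and> (\<forall>j\<in>J. (\<Sum>i\<in>I. u i * B i j) = p j)"
proof -
  define f where "f z = (\<Sum>j\<in>J. p j * z j) + (\<Sum>i\<in>I. (max 0 (- (\<Sum>j\<in>J. B i j * z j)))\<^sup>2)" for z
  define D where "D = {z :: 'j \<Rightarrow> real. (\<forall>j. j \<notin> J \<longrightarrow> z j = 0) \<and> (\<Sum>j\<in>J. \<bar>z j\<bar>) \<le> M}"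
  have "continuous_on UNIV f"
    unfolding f_def by (intro continuous_intros continuous_on_product_coordinates)
  then have cont: "continuous_on D f" by (rule continuous_on_subset) simp
  have "compact D" unfolding D_def by (rule compact_l1_ball[OF \<open>finite J\<close>])
  have 0: "(\<lambda>_. 0) \<in> D" using \<open>0 \<le> M\<close> by (simp add: D_def)
  then have "D \<noteq> {}" by blast
  from continuous_attains_inf[OF \<open>compact D\<close> this cont]
  obtain z where z: "z \<in> D" and min: "\<And>w. w \<in> D \<Longrightarrow> f z \<le> f w" by blast
  have f0: "f z \<le> 0" using min[OF 0] by (simp add: f_def)
  have global: "f z \<le> f w" if "\<And>j. j \<notin> J \<Longrightarrow> w j = 0" for w
  proof (cases "w \<in> D")
    case True
    then show ?thesis by (rule min)
  next
    case False
    then have "0 \<le> f w" using that unfolding f_def D_def by (intro coercive) auto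
    then show ?thesis using f0 by linarith
  qed
  let ?u = "\<lambda>i. 2 * max 0 (- (\<Sum>j\<in>J. B i j * z j))"
  have "(\<Sum>i\<in>I. ?u i * B i j) = p j" if "j \<in> J" for j
    using z by (intro minimizer_imp_in_cone[OF assms(1,2) that global[unfolded f_def]])
      (auto simp: D_def)
  then show ?thesis by (intro exI[of _ ?u]) simp
qed

section \<open>Uniform coercivity near \<open>c\<close>\<close>

text \<open>By \<open>none\<close>, the larger of the linear term and the penalty is positive at
  each point of the l1 unit sphere. Compactness of the sphere bounds it below by some
  \<open>\<eta> > 0\<close>.\<close>

lemma uniform_alternative:
  fixes B :: "'i \<Rightarrow> 'j \<Rightarrow> real"
  assumes "finite I" "finite J"
    and none: "\<forall>z. (\<exists>j\<in>J. z j \<noteq> 0) \<longrightarrow> (\<forall>i\<in>I. 0 \<le> (\<Sum>j\<in>J. B i j * z j)) \<longrightarrow> 0 < (\<Sum>j\<in>J. c j * z j)"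
  shows "\<exists>\<eta>>0. \<forall>z. (\<forall>j. j \<notin> J \<longrightarrow> z j = 0) \<longrightarrow> (\<Sum>j\<in>J. \<bar>z j\<bar>) = 1 \<longrightarrow>
    \<eta> \<le> (\<Sum>j\<in>J. c j * z j) \<or> \<eta> \<le> (\<Sum>i\<in>I. (max 0 (- (\<Sum>j\<in>J. B i j * z j)))\<^sup>2)"
proof -
  let ?s = "\<lambda>z. \<Sum>i\<in>I. (max 0 (- (\<Sum>j\<in>J. B i j * z j)))\<^sup>2"
  let ?\<phi> = "\<lambda>z. max (\<Sum>j\<in>J. c j * z j) (?s z)"
  let ?S = "{z :: 'j \<Rightarrow> real. (\<forall>j. j \<notin> J \<longrightarrow> z j = 0) \<and> (\<Sum>j\<in>J. \<bar>z j\<bar>) \<le> 1}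
    \<inter> {z. (\<Sum>j\<in>J. \<bar>z j\<bar>) = 1}"
  have "closed {z :: 'j \<Rightarrow> real. (\<Sum>j\<in>J. \<bar>z j\<bar>) = 1}"
    by (intro closed_Collect_eq continuous_intros continuous_on_product_coordinates)
  then have S: "compact ?S"
    using compact_l1_ball[OF \<open>finite J\<close>, of 1] by blast
  have cont: "continuous_on ?S ?\<phi>"
    by (rule continuous_on_subset[OF _ subset_UNIV])
      (intro continuous_intros continuous_on_product_coordinates)
  have pos: "0 < ?\<phi> z" if z: "z \<in> ?S" for z
  proof (cases "\<forall>i\<in>I. 0 \<le> (\<Sum>j\<in>J. B i j * z j)")
    case True
    have "\<exists>j\<in>J. z j \<noteq> 0"
    proof (rule ccontr)
      assume "\<not> ?thesis"
      then have "(\<Sum>j\<in>J. \<bar>z j\<bar>) = 0" by simp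
      then show False using z by simp
    qed
    then have "0 < (\<Sum>j\<in>J. c j * z j)" using none True by blast
    then show ?thesis by simp
  next
    case False
    then obtain i where "i \<in> I" "(\<Sum>j\<in>J. B i j * z j) < 0" by force
    then have "0 < ?s z"
      by (intro sum_pos2[OF \<open>finite I\<close>]) auto
    then show ?thesis by simp
  qed
  show ?thesis
  proof (cases "?S = {}")
    case True
    \<comment> \<open>The sphere is empty exactly when \<open>J\<close> is; the claim is then
      vacuous and the value 1 arbitrary.\<close>
    then show ?thesis by (intro exI[of _ 1]) auto
  next
    case False
    then obtain w where w: "w \<in> ?S" "\<And>z. z \<in> ?S \<Longrightarrow> ?\<phi> w \<le> ?\<phi> z"
      using continuous_attains_inf[OF S _ cont] by blast
    show ?thesis
    proof (intro exI[of _ "?\<phi> w"] conjI allI impI)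
      show "0 < ?\<phi> w" using pos[OF w(1)] .
      fix z :: "'j \<Rightarrow> real"
      assume "\<forall>j. j \<notin> J \<longrightarrow> z j = 0" "(\<Sum>j\<in>J. \<bar>z j\<bar>) = 1"
      then have "?\<phi> w \<le> ?\<phi> z" by (intro w(2)) simp
      then show "?\<phi> w \<le> (\<Sum>j\<in>J. c j * z j) \<or> ?\<phi> w \<le> ?s z"
        by (simp only: le_max_iff_disj)
    qed
  qed
qed

text \<open>Along a ray \<open>z = r * y\<close> with \<open>y\<close> on the sphere, the linear
  term grows like \<open>r\<close> and the penalty like \<open>r\<^sup>2\<close>. Where the linear
  term is not bounded below by \<open>\<eta>\<close>, the penalty is, and it wins once
  \<open>r\<close> reaches a bound independent of \<open>p\<close>. Thus
  \<open>coercive_imp_in_cone\<close> applies to all \<open>p\<close> near \<open>c\<close>.\<close>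

lemma alternative_imp_cone_nhd:
  fixes B :: "'i \<Rightarrow> 'j \<Rightarrow> real"
  assumes "finite I" "finite J"
    and none: "\<forall>z. (\<exists>j\<in>J. z j \<noteq> 0) \<longrightarrow> (\<forall>i\<in>I. 0 \<le> (\<Sum>j\<in>J. B i j * z j)) \<longrightarrow> 0 < (\<Sum>j\<in>J. c j * z j)"
  shows "\<exists>\<delta>>0. \<forall>p. (\<forall>j\<in>J. \<bar>p j - c j\<bar> \<le> \<delta>) \<longrightarrow>
    (\<exists>u. (\<forall>i\<in>I. 0 \<le> u i) \<and> (\<forall>j\<in>J. (\<Sum>i\<in>I. u i * B i j) = p j))"
proof -
  let ?s = "\<lambda>z. \<Sum>i\<in>I. (max 0 (- (\<Sum>j\<in>J. B i j * z j)))\<^sup>2"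
  obtain \<eta> where "\<eta> > 0" and \<eta>: "\<forall>z. (\<forall>j. j \<notin> J \<longrightarrow> z j = 0) \<longrightarrow> (\<Sum>j\<in>J. \<bar>z j\<bar>) = 1 \<longrightarrow>
      \<eta> \<le> (\<Sum>j\<in>J. c j * z j) \<or> \<eta> \<le> ?s z"
    using uniform_alternative[OF assms] by (elim exE conjE) rule
  \<comment> \<open>On the sphere the linear term is at least \<open>- L\<close>. The radius
    \<open>M\<close> satisfies \<open>M * \<eta> = L + \<eta>\<close>, so a penalty of at least
    \<open>\<eta>\<close>, scaled by \<open>M\<close>, offsets this worst case and leaves a surplus
    of \<open>\<eta>\<close>.\<close>
  define L where "L = (\<Sum>j\<in>J. \<bar>c j\<bar>)"
  define M where "M = (L + \<eta>) / \<eta>"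
  have "L \<ge> 0" by (simp add: L_def sum_nonneg)
  then have "M \<ge> 0" "M * \<eta> = L + \<eta>" using \<open>\<eta> > 0\<close> by (auto simp: M_def)
  have sphere: "\<eta> \<le> (\<Sum>j\<in>J. c j * y j) + M * ?s y"
    if y: "\<And>j. j \<notin> J \<Longrightarrow> y j = 0" "(\<Sum>j\<in>J. \<bar>y j\<bar>) = 1" for y
  proof -
    have "\<eta> \<le> (\<Sum>j\<in>J. c j * y j) \<or> \<eta> \<le> ?s y"
      using y by (intro \<eta>[rule_format]) auto
    then show ?thesis
    proof
      assume "\<eta> \<le> (\<Sum>j\<in>J. c j * y j)"
      moreover have "0 \<le> M * ?s y" using \<open>M \<ge> 0\<close> by (simp add: sum_nonneg)
      ultimately show ?thesis by linarith
    next
      assume "\<eta> \<le> ?s y"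
      then have "L + \<eta> \<le> M * ?s y"
        using mult_left_mono[of \<eta> "?s y" M] \<open>M \<ge> 0\<close> \<open>M * \<eta> = L + \<eta>\<close> by simp
      moreover have "- L \<le> (\<Sum>j\<in>J. c j * y j)"
      proof -
        have "\<bar>c j * y j\<bar> \<le> \<bar>c j\<bar>" if "j \<in> J" for j
        proof -
          have "\<bar>y j\<bar> \<le> 1"
            using member_le_sum[of j J "\<lambda>j. \<bar>y j\<bar>"] that \<open>finite J\<close> y(2) by simp
          then show ?thesis by (simp add: abs_mult mult_left_le)
        qed
        then have "\<bar>\<Sum>j\<in>J. c j * y j\<bar> \<le> L"
          unfolding L_def by (intro order_trans[OF sum_abs] sum_mono)
        then show ?thesis by linarith
      qed
      ultimately show ?thesis by linarith
    qed
  qed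
  \<comment> \<open>The same \<open>\<eta>\<close> serves as the radius: on the l1 sphere, replacing
    \<open>c\<close> by \<open>p\<close> changes the linear term by at most \<open>\<eta>\<close>,
    which is the surplus in \<open>sphere\<close>.\<close>
  show ?thesis
  proof (intro exI[of _ \<eta>] conjI allI impI \<open>\<eta> > 0\<close>)
    fix p assume p: "\<forall>j\<in>J. \<bar>p j - c j\<bar> \<le> \<eta>"
    show "\<exists>u. (\<forall>i\<in>I. 0 \<le> u i) \<and> (\<forall>j\<in>J. (\<Sum>i\<in>I. u i * B i j) = p j)"
    proof (rule coercive_imp_in_cone[OF assms(1,2) \<open>M \<ge> 0\<close>])
      fix z :: "'j \<Rightarrow> real"
      assume supp: "\<And>j. j \<notin> J \<Longrightarrow> z j = 0" and large: "(\<Sum>j\<in>J. \<bar>z j\<bar>) > M"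
      define r where "r = (\<Sum>j\<in>J. \<bar>z j\<bar>)"
      define y where "y = (\<lambda>j. z j / r)"
      have "r > 0" "r \<ge> M" using large \<open>M \<ge> 0\<close> by (auto simp: r_def)
      have zy: "z j = r * y j" for j using \<open>r > 0\<close> by (simp add: y_def)
      have "(\<Sum>j\<in>J. \<bar>y j\<bar>) = (\<Sum>j\<in>J. \<bar>z j\<bar>) / r"
        using \<open>r > 0\<close> by (simp add: y_def sum_divide_distrib)
      then have y: "\<And>j. j \<notin> J \<Longrightarrow> y j = 0" "(\<Sum>j\<in>J. \<bar>y j\<bar>) = 1"
        using supp \<open>r > 0\<close> by (simp_all add: y_def flip: r_def)
      have "\<bar>\<Sum>j\<in>J. (p j - c j) * y j\<bar> \<le> (\<Sum>j\<in>J. \<eta> * \<bar>y j\<bar>)"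
        using p by (intro order_trans[OF sum_abs] sum_mono) (simp add: abs_mult mult_right_mono)
      also have "\<dots> = \<eta>" using y(2) by (simp flip: sum_distrib_left)
      finally have "(\<Sum>j\<in>J. c j * y j) - \<eta> \<le> (\<Sum>j\<in>J. p j * y j)"
        by (simp add: left_diff_distrib sum_subtractf)
      moreover have "M * ?s y \<le> r * ?s y"
        using \<open>r \<ge> M\<close> by (intro mult_right_mono sum_nonneg) auto
      ultimately have "0 \<le> (\<Sum>j\<in>J. p j * y j) + r * ?s y"
        using sphere[OF y] by linarith
      then have "0 \<le> r * ((\<Sum>j\<in>J. p j * y j) + r * ?s y)"
        using \<open>r > 0\<close> by simp
      \<comment> \<open>The linear term is homogeneous of degree one and the penalty of degree
        two.\<close>
      also have "\<dots> = (\<Sum>j\<in>J. p j * z j) + ?s z"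
      proof -
        have "(max 0 (- (\<Sum>j\<in>J. B i j * z j)))\<^sup>2 = r\<^sup>2 * (max 0 (- (\<Sum>j\<in>J. B i j * y j)))\<^sup>2" for i
        proof -
          have "(\<Sum>j\<in>J. B i j * z j) = r * (\<Sum>j\<in>J. B i j * y j)"
            by (simp add: zy sum_distrib_left mult_ac)
          then have "max 0 (- (\<Sum>j\<in>J. B i j * z j)) = r * max 0 (- (\<Sum>j\<in>J. B i j * y j))"
            using \<open>r > 0\<close> by (simp add: max_mult_distrib_left)
          then show ?thesis by (simp add: power_mult_distrib)
        qed
        then have "?s z = r\<^sup>2 * ?s y" by (simp add: sum_distrib_left)
        moreover have "(\<Sum>j\<in>J. p j * z j) = r * (\<Sum>j\<in>J. p j * y j)"
          by (simp add: zy sum_distrib_left mult_ac)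
        ultimately show ?thesis by (simp add: algebra_simps power2_eq_square)
      qed
      finally show "0 \<le> (\<Sum>j\<in>J. p j * z j) + ?s z" .
    qed
  qed
qed

section \<open>Enumeration of \<open>J\<close>, eigenvectors of a diagonal matrix, and the
  norm\<close>

lemma bij_betw_pick: "finite J \<Longrightarrow> bij_betw (pick J) {..<card J} J"
proof -
  assume fin: "finite J"
  have inj: "inj_on (pick J) {..<card J}"
    by (rule inj_onI) (metis card_pick_le lessThan_iff)
  moreover have "pick J ` {..<card J} \<subseteq> J" by (auto simp: pick_in_set_le)
  ultimately show ?thesis
    by (simp add: bij_betw_def card_image card_subset_eq fin)
qed

lemma eigenvector_mat_diag_iff:
  fixes q :: "nat \<Rightarrow> real"
  assumes "d \<in> carrier_vec n"
  shows "mat_diag n q *\<^sub>v d = l \<cdot>\<^sub>v d \<longleftrightarrow> (\<forall>j<n. q j \<noteq> l \<longrightarrow> vec_index d j = 0)"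
proof -
  have "vec_index (mat_diag n q *\<^sub>v d) j = q j * vec_index d j" if "j < n" for j
    using assms that unfolding mat_diag_def
    by (simp add: scalar_prod_def row_def if_distrib[of "\<lambda>x. x * _"] sum.delta cong: if_cong)
  then show ?thesis
    using assms by (auto simp: vec_eq_iff mat_diag_def)
qed

text \<open>Converts the Euclidean bound on a perturbation into the coordinatewise bound of
  \<open>alternative_imp_cone_nhd\<close>.\<close>

lemma abs_vec_index_le_vec_norm:
  assumes "j < dim_vec v"
  shows "\<bar>vec_index v j\<bar> \<le> vec_norm v"
proof -
  have "\<bar>vec_index v j\<bar> \<le> L2_set (\<lambda>i. \<bar>vec_index v i\<bar>) {..<dim_vec v}"
    using assms by (intro member_le_L2_set) auto
  also have "\<dots> = vec_norm v" unfolding vec_norm_def L2_set_def by simp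
  finally show ?thesis .
qed

section \<open>The equivalence in coordinates\<close>

lemma exists_direction_iff_not_cone_nhd:
  fixes B :: "nat \<Rightarrow> nat \<Rightarrow> real" and c :: "nat \<Rightarrow> real"
  shows "(\<exists>z. (\<exists>j<k. z j \<noteq> 0) \<and> (\<forall>i<m. 0 \<le> (\<Sum>j<k. B i j * z j)) \<and> (\<Sum>j<k. c j * z j) \<le> 0)
    \<longleftrightarrow> (\<forall>\<epsilon>>0. \<exists>h \<in> carrier_vec k. vec_norm h \<le> \<epsilon> \<and>
          \<not> (\<exists>u. (\<forall>i<m. 0 \<le> u i) \<and> (\<forall>j<k. (\<Sum>i<m. u i * B i j) = c j + vec_index h j)))"
    (is "?L \<longleftrightarrow> ?R")
proof
  assume ?L
  then obtain z where nz: "\<exists>j<k. z j \<noteq> 0" and Bz: "\<forall>i<m. 0 \<le> (\<Sum>j<k. B i j * z j)"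
    and cz: "(\<Sum>j<k. c j * z j) \<le> 0" by blast
  define N where "N = L2_set z {..<k}"
  have "N \<noteq> 0" using nz by (auto simp: N_def L2_set_eq_0_iff)
  then have "N > 0" by (simp add: N_def order_less_le)
  show ?R
  proof (intro allI impI)
    fix \<epsilon> :: real assume "\<epsilon> > 0"
    \<comment> \<open>Moving from \<open>c\<close> against \<open>z\<close>, rescaled to norm
      exactly \<open>\<epsilon>\<close>, leaves the cone.\<close>
    define h where "h = Matrix.vec k (\<lambda>j. - (\<epsilon> / N) * z j)"
    have "vec_norm h = L2_set (\<lambda>j. (\<epsilon> / N) * z j) {..<k}"
      by (simp add: vec_norm_def h_def L2_set_def)
    also have "\<dots> = (\<epsilon> / N) * N"
      using \<open>\<epsilon> > 0\<close> \<open>N > 0\<close>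
      by (intro L2_set_right_distrib[of "\<epsilon> / N" z "{..<k}", folded N_def, symmetric]) simp
    also have "\<dots> = \<epsilon>" using \<open>N > 0\<close> by simp
    finally have "vec_norm h \<le> \<epsilon>" by simp
    moreover have False
      if u: "\<forall>i<m. 0 \<le> u i" "\<forall>j<k. (\<Sum>i<m. u i * B i j) = c j + vec_index h j" for u
    proof -
      \<comment> \<open>Pairing the equation for \<open>u\<close> with \<open>z\<close> yields the
        contradiction: the cone side is nonnegative because \<open>u\<close> and \<open>B z\<close>
        are, while the other side is at most \<open>- (\<epsilon> / N)\<close> times the squared
        norm of \<open>z\<close>.\<close>
      have "0 \<le> (\<Sum>i<m. u i * (\<Sum>j<k. B i j * z j))"
        using u(1) Bz by (intro sum_nonneg) simp
      also have "\<dots> = (\<Sum>j<k. (\<Sum>i<m. u i * B i j) * z j)"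
        unfolding sum_distrib_left sum_distrib_right
        by (subst sum.swap) (simp add: mult.assoc)
      also have "\<dots> = (\<Sum>j<k. (c j + - (\<epsilon> / N) * z j) * z j)"
        using u(2) by (simp add: h_def)
      also have "\<dots> = (\<Sum>j<k. c j * z j) - \<epsilon> / N * (\<Sum>j<k. (z j)\<^sup>2)"
        by (simp add: algebra_simps sum.distrib sum_subtractf sum_distrib_left power2_eq_square)
      also have "\<dots> < 0"
      proof -
        have "0 < (\<Sum>j<k. (z j)\<^sup>2)" using nz by (auto intro!: sum_pos2)
        then have "0 < \<epsilon> / N * (\<Sum>j<k. (z j)\<^sup>2)" using \<open>\<epsilon> > 0\<close> \<open>N > 0\<close> by simp
        then show ?thesis using cz by linarith
      qed
      finally show False by simp
    qed
    ultimately show "\<exists>h \<in> carrier_vec k. vec_norm h \<le> \<epsilon> \<and>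
        \<not> (\<exists>u. (\<forall>i<m. 0 \<le> u i) \<and> (\<forall>j<k. (\<Sum>i<m. u i * B i j) = c j + vec_index h j))"
      by (intro bexI[of _ h]) (auto simp: h_def)
  qed
next
  assume R: ?R
  show ?L
  proof (rule ccontr)
    assume "\<not> ?L"
    have "\<forall>z. (\<exists>j\<in>{..<k}. z j \<noteq> 0) \<longrightarrow> (\<forall>i\<in>{..<m}. 0 \<le> (\<Sum>j<k. B i j * z j)) \<longrightarrow>
        0 < (\<Sum>j<k. c j * z j)"
    proof (intro allI impI)
      fix z :: "nat \<Rightarrow> real"
      assume "\<exists>j\<in>{..<k}. z j \<noteq> 0" "\<forall>i\<in>{..<m}. 0 \<le> (\<Sum>j<k. B i j * z j)"
      then have "\<exists>j<k. z j \<noteq> 0" "\<forall>i<m. 0 \<le> (\<Sum>j<k. B i j * z j)" by auto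
      then show "0 < (\<Sum>j<k. c j * z j)" using \<open>\<not> ?L\<close> not_le by blast
    qed
    from alternative_imp_cone_nhd[OF finite_lessThan finite_lessThan this]
    obtain \<delta> where "\<delta> > 0" and \<delta>: "\<forall>p. (\<forall>j\<in>{..<k}. \<bar>p j - c j\<bar> \<le> \<delta>) \<longrightarrow>
        (\<exists>u. (\<forall>i\<in>{..<m}. 0 \<le> u i) \<and> (\<forall>j\<in>{..<k}. (\<Sum>i<m. u i * B i j) = p j))"
      by (elim exE conjE) rule
    \<comment> \<open>Taking \<open>\<epsilon> = \<delta>\<close> puts \<open>c + h\<close> outside
      the cone, yet inside the neighbourhood of \<open>c\<close> that the cone contains.\<close>
    from R[rule_format, OF \<open>\<delta> > 0\<close>] obtain h where h: "h \<in> carrier_vec k" "vec_norm h \<le> \<delta>"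
      "\<not> (\<exists>u. (\<forall>i<m. 0 \<le> u i) \<and> (\<forall>j<k. (\<Sum>i<m. u i * B i j) = c j + vec_index h j))"
      by (elim bexE conjE) rule
    have "\<bar>vec_index h j\<bar> \<le> \<delta>" if "j < k" for j
      using h(1,2) abs_vec_index_le_vec_norm[of j h] that by simp
    then have "\<exists>u. (\<forall>i\<in>{..<m}. 0 \<le> u i) \<and>
        (\<forall>j\<in>{..<k}. (\<Sum>i<m. u i * B i j) = c j + vec_index h j)"
      using spec[OF \<delta>, of "\<lambda>j. c j + vec_index h j"] by simp
    then show False using h(3) by blast
  qed
qed

section \<open>Translation between matrices and coordinate sums\<close>

theorem lemma8:
  fixes n m :: nat
    and q :: "nat \<Rightarrow> real"
    and Q A A\<^sub>J :: "real mat"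
    and g g\<^sub>J :: "real vec"
    and K :: "real vec set"
    and lamQ :: real
    and J :: "nat set"
  assumes "n \<ge> 1"
    and "Q = mat_diag n q"
    and "lamQ = Min (q ` {..<n})"
    and "lamQ < 0"
    and "g \<in> carrier_vec n"
    and "A \<in> carrier_mat m n"
    and "K = nonneg_orthant m"
    and "J = {j. j < n \<and> q j = lamQ}"
    and "A\<^sub>J = submatrix A UNIV J"
    and "g\<^sub>J = subvec g J"
  shows "(\<exists>d \<in> carrier_vec n. d \<noteq> 0\<^sub>v n \<and> Q *\<^sub>v d = lamQ \<cdot>\<^sub>v d \<and> A *\<^sub>v d \<in> K \<and> g \<bullet> d \<le> 0)
    \<longleftrightarrow> (\<forall>\<epsilon>>0. \<exists>h \<in> carrier_vec (card J). vec_norm h \<le> \<epsilon> \<and>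
          {\<mu> \<in> carrier_vec m. 0\<^sub>v m \<le> \<mu> \<and>
             - (transpose_mat A\<^sub>J *\<^sub>v \<mu>) + g\<^sub>J + h = 0\<^sub>v (card J)} = {})"
proof -
  define k where "k = card J"
  define B where "B = (\<lambda>i j. A $$ (i, pick J j))"
  define c where "c = (\<lambda>j. vec_index g (pick J j))"
  have J: "J \<subseteq> {..<n}" "finite J" using assms(8) by auto
  have bij: "bij_betw (pick J) {..<k} J"
    unfolding k_def by (rule bij_betw_pick[OF J(2)])
  have AJ: "A\<^sub>J \<in> carrier_mat m k" "\<And>i j. i < m \<Longrightarrow> j < k \<Longrightarrow> A\<^sub>J $$ (i, j) = B i j"
  proof -
    have "{j. j < dim_col A \<and> j \<in> J} = J" "dim_row A = m" using J(1) assms(6) by auto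
    then show "A\<^sub>J \<in> carrier_mat m k" "\<And>i j. i < m \<Longrightarrow> j < k \<Longrightarrow> A\<^sub>J $$ (i, j) = B i j"
      unfolding assms(9) k_def B_def submatrix_def by (auto simp: pick_UNIV)
  qed
  have gJ: "g\<^sub>J = Matrix.vec k c"
  proof -
    have "{j. j < dim_vec g \<and> j \<in> J} = J" using J(1) assms(5) by auto
    then show ?thesis by (simp add: assms(10) subvec_def k_def c_def)
  qed
  have reindex: "(\<Sum>j<n. f j * vec_index d j) = (\<Sum>j<k. f (pick J j) * vec_index d (pick J j))"
    if "\<forall>j<n. j \<notin> J \<longrightarrow> vec_index d j = 0" for f and d :: "real vec"
  proof -
    have "(\<Sum>j<n. f j * vec_index d j) = (\<Sum>j\<in>J. f j * vec_index d j)"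
      using J that by (intro sum.mono_neutral_right) auto
    also have "\<dots> = (\<Sum>j<k. f (pick J j) * vec_index d (pick J j))"
      by (rule sum.reindex_bij_betw[OF bij, symmetric])
    finally show ?thesis .
  qed
  \<comment> \<open>The eigenvector equation says that \<open>d\<close> is supported on
    \<open>J\<close>. Under this condition the remaining ones reindex along \<open>pick J\<close>;
    without it both sides are false.\<close>
  have cond: "d \<noteq> 0\<^sub>v n \<and> Q *\<^sub>v d = lamQ \<cdot>\<^sub>v d \<and> A *\<^sub>v d \<in> K \<and> g \<bullet> d \<le> 0 \<longleftrightarrow>
      (\<exists>j<k. vec_index d (pick J j) \<noteq> 0) \<and> (\<forall>j<n. j \<notin> J \<longrightarrow> vec_index d j = 0) \<and>
      (\<forall>i<m. 0 \<le> (\<Sum>j<k. B i j * vec_index d (pick J j))) \<and>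
      (\<Sum>j<k. c j * vec_index d (pick J j)) \<le> 0"
    if d: "d \<in> carrier_vec n" for d
  proof -
    have 1: "Q *\<^sub>v d = lamQ \<cdot>\<^sub>v d \<longleftrightarrow> (\<forall>j<n. j \<notin> J \<longrightarrow> vec_index d j = 0)"
      using eigenvector_mat_diag_iff[OF d] assms(2,8) by auto
    show ?thesis
    proof (cases "\<forall>j<n. j \<notin> J \<longrightarrow> vec_index d j = 0")
      case True
      have "d \<noteq> 0\<^sub>v n \<longleftrightarrow> (\<exists>j\<in>J. vec_index d j \<noteq> 0)"
        using d True J(1) by (auto simp: vec_eq_iff)
      also have "\<dots> \<longleftrightarrow> (\<exists>j<k. vec_index d (pick J j) \<noteq> 0)"
        using bij_betw_imp_surj_on[OF bij] by (metis (no_types, lifting) imageE imageI lessThan_iff)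
      moreover have "vec_index (A *\<^sub>v d) i = (\<Sum>j<k. B i j * vec_index d (pick J j))" if "i < m" for i
        using d assms(6) that reindex[OF True, of "\<lambda>j. A $$ (i, j)"]
        by (simp add: scalar_prod_def B_def atLeast0LessThan)
      then have "A *\<^sub>v d \<in> K \<longleftrightarrow> (\<forall>i<m. 0 \<le> (\<Sum>j<k. B i j * vec_index d (pick J j)))"
        using mult_mat_vec_carrier[OF assms(6) d] carrier_matD(1)[OF assms(6)]
        by (auto simp: assms(7) nonneg_orthant_def less_eq_vec_def simp del: index_mult_mat_vec)
      moreover have "g \<bullet> d = (\<Sum>j<k. c j * vec_index d (pick J j))"
        using d reindex[OF True, of "vec_index g"]
        by (simp add: scalar_prod_def c_def atLeast0LessThan)
      ultimately show ?thesis using 1 by simp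
    next
      case False
      show ?thesis by (simp only: 1 False simp_thms)
    qed
  qed
  \<comment> \<open>Every coordinate vector \<open>z\<close> extends by zero to a vector supported
    on \<open>J\<close>; the inverse of \<open>pick J\<close> tells which entry of \<open>z\<close>
    goes to which position.\<close>
  have lift: "\<exists>d \<in> carrier_vec n. (\<forall>j<n. j \<notin> J \<longrightarrow> vec_index d j = 0) \<and>
      (\<forall>j<k. vec_index d (pick J j) = z j)" for z :: "nat \<Rightarrow> real"
  proof -
    let ?d = "Matrix.vec n (\<lambda>j. if j \<in> J then z (the_inv_into {..<k} (pick J) j) else 0)"
    have "vec_index ?d (pick J j) = z j" if "j < k" for j
    proof -
      have "pick J j \<in> J" "pick J j < n" using bij J(1) that by (auto simp: bij_betw_def)
      moreover have "the_inv_into {..<k} (pick J) (pick J j) = j"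
        using bij that by (intro the_inv_into_f_f) (auto simp: bij_betw_def)
      ultimately show ?thesis by simp
    qed
    then show ?thesis by (intro bexI[of _ ?d]) auto
  qed
  have DZ: "(\<exists>d \<in> carrier_vec n. d \<noteq> 0\<^sub>v n \<and> Q *\<^sub>v d = lamQ \<cdot>\<^sub>v d \<and> A *\<^sub>v d \<in> K \<and> g \<bullet> d \<le> 0)
    \<longleftrightarrow> (\<exists>z. (\<exists>j<k. z j \<noteq> 0) \<and> (\<forall>i<m. 0 \<le> (\<Sum>j<k. B i j * z j)) \<and> (\<Sum>j<k. c j * z j) \<le> 0)"
    (is "?D \<longleftrightarrow> ?Z")
  proof
    assume ?D
    then obtain d where "d \<in> carrier_vec n" "d \<noteq> 0\<^sub>v n \<and> Q *\<^sub>v d = lamQ \<cdot>\<^sub>v d \<and> A *\<^sub>v d \<in> K \<and> g \<bullet> d \<le> 0"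
      by (elim bexE) rule
    then show ?Z
      by (intro exI[of _ "\<lambda>j. vec_index d (pick J j)"]) (simp add: cond)
  next
    assume ?Z
    then obtain z where z: "(\<exists>j<k. z j \<noteq> 0) \<and> (\<forall>i<m. 0 \<le> (\<Sum>j<k. B i j * z j)) \<and>
      (\<Sum>j<k. c j * z j) \<le> 0" by (rule exE)
    obtain d where "d \<in> carrier_vec n" "\<forall>j<n. j \<notin> J \<longrightarrow> vec_index d j = 0"
      "\<forall>j<k. vec_index d (pick J j) = z j" using lift by blast
    then show ?D using z by (intro bexI[of _ d]) (auto simp: cond)
  qed
  \<comment> \<open>Only the entries below \<open>m\<close> matter, so a multiplier function
    \<open>u\<close> and a vector \<open>\<mu>\<close> of dimension \<open>m\<close> can be
    exchanged for each other.\<close>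
  have EU: "{\<mu> \<in> carrier_vec m. 0\<^sub>v m \<le> \<mu> \<and>
        - (transpose_mat A\<^sub>J *\<^sub>v \<mu>) + g\<^sub>J + h = 0\<^sub>v k} = {} \<longleftrightarrow>
      \<not> (\<exists>u. (\<forall>i<m. 0 \<le> u i) \<and> (\<forall>j<k. (\<Sum>i<m. u i * B i j) = c j + vec_index h j))"
    (is "?E = {} \<longleftrightarrow> \<not> ?U") if h: "h \<in> carrier_vec k" for h
  proof -
    have mem: "\<mu> \<in> ?E \<longleftrightarrow> (\<forall>i<m. 0 \<le> vec_index \<mu> i) \<and>
        (\<forall>j<k. (\<Sum>i<m. vec_index \<mu> i * B i j) = c j + vec_index h j)"
      if \<mu>: "\<mu> \<in> carrier_vec m" for \<mu>
    proof -
      have "vec_index (transpose_mat A\<^sub>J *\<^sub>v \<mu>) j = (\<Sum>i<m. vec_index \<mu> i * B i j)" if "j < k" for j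
        using AJ \<mu> that by (simp add: scalar_prod_def atLeast0LessThan mult.commute)
      then have "- (transpose_mat A\<^sub>J *\<^sub>v \<mu>) + g\<^sub>J + h = 0\<^sub>v k \<longleftrightarrow>
          (\<forall>j<k. - (\<Sum>i<m. vec_index \<mu> i * B i j) + c j + vec_index h j = 0)"
        using h AJ(1) by (simp add: vec_eq_iff gJ)
      moreover have "0\<^sub>v m \<le> \<mu> \<longleftrightarrow> (\<forall>i<m. 0 \<le> vec_index \<mu> i)"
        using \<mu> by (auto simp: less_eq_vec_def)
      moreover have "- x + y + w = 0 \<longleftrightarrow> x = y + w" for x y w :: real by linarith
      ultimately show ?thesis using \<mu> by simp
    qed
    have "?U \<longleftrightarrow> (\<exists>\<mu> \<in> carrier_vec m. \<mu> \<in> ?E)"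
    proof
      assume ?U
      then obtain u where u: "\<forall>i<m. 0 \<le> u i" "\<forall>j<k. (\<Sum>i<m. u i * B i j) = c j + vec_index h j"
        by (elim exE conjE) rule
      then have "Matrix.vec m u \<in> ?E" by (subst mem) auto
      then show "\<exists>\<mu> \<in> carrier_vec m. \<mu> \<in> ?E" by auto
    next
      assume "\<exists>\<mu> \<in> carrier_vec m. \<mu> \<in> ?E"
      then obtain \<mu> where \<mu>: "\<mu> \<in> carrier_vec m" "\<mu> \<in> ?E" by (rule bexE)
      from mem[OF \<mu>(1)] \<mu>(2) show ?U by (intro exI[of _ "vec_index \<mu>"]) (rule iffD1)
    qed
    then show ?thesis by blast
  qed
  \<comment> \<open>\<open>EU\<close> requires \<open>h\<close> to have dimension \<open>k\<close>;
    the congruence rule supplies this from the bounded quantifier.\<close>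
  show ?thesis
    unfolding DZ exists_direction_iff_not_cone_nhd[of k m B c] k_def[symmetric]
    by (simp only: EU cong: bex_cong)
qed

end
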